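(* Let $X$ be a random variable supported on a finite set of integers, and let $f:[0,+\infty)\to[0,+\infty)$ be non-decreasing. Then \[ D_f(X^+)\le D_f(X). \] Furthermore, suppose in addition that $f$ is differentiable with $f'(x)>0$ for every $x>0$, and that $f$ has a right derivative at $0$ with $f'(0+)=0$. Then the inequality $D_f(X^+)\le D_f(X)$ is strict unless $X-k$ has the same distribution as $X^+$ or as $-X^+$ for some integer $k$.
   Context: For a random variable $Y$ and a non-decreasing function $f:[0,+\infty)\to[0,+\infty)$ with $\inf_{a\in\mathbb{R}}\mathbb{E} f(|Y-a|)<\infty$, define $D_f(Y):=\min_{a\in\mathbb{R}}\mathbb{E} f(|Y-a|)$ and $M_f(Y):=\arg\min_{a\in\mathbb{R}}\mathbb{E} f(|Y-a|)$. Rearrangement $X^+$: if $X$ is supported on the distinct integers $x_1,\dots,x_N$ with $p_i=\mathbb{P}(X=x_i)$, let $(p^{(1)},\dots,p^{(N)})$ be the sequence $(p_1,\dots,p_N)$ sorted in non-increasing order. Then $X^+$ is the random variable with $\mathbb{P}(X^+=(-1)^i\lfloor i/2\rfloor)=p^{(i)}$ for $i=1,\dots,N$, i.e. $\mathbb{P}(X^+=0)=p^{(1)}$, $\mathbb{P}(X^+=1)=p^{(2)}$, $\mathbb{P}(X^+=-1)=p^{(3)}$, $\mathbb{P}(X^+=2)=p^{(4)}$, and so on.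
   Formalization: D_f(Y) is taken as the infimum over real a of E f(|Y−a|) (in [0,∞]) instead of the minimum, since for a merely non-decreasing f the minimum need not be attained; the two agree whenever the minimum exists, in particular under the extra hypotheses of the second part. *)

theory Defs
  imports "HOL-Probability.Probability"
begin

text \<open>
  The expectation of the nonnegative variable \<open>f \<bar>Y - a\<bar>\<close> is taken in \<open>[0, \<infinity>]\<close>, so no
  integrability proviso is needed.
\<close>

definition expected_loss :: "(real \<Rightarrow> real) \<Rightarrow> 'a measure \<Rightarrow> ('a \<Rightarrow> real) \<Rightarrow> real \<Rightarrow> ennreal" where
  "expected_loss f M Y a = (\<integral>\<^sup>+ \<omega>. ennreal (f \<bar>Y \<omega> - a\<bar>) \<partial>M)"

text \<open>
  \<open>D\<^sub>f(Y)\<close> is the minimum over \<open>a\<close> of the expected loss. If \<open>f\<close> is not left-continuous the minimum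
  need not be attained, even for \<open>Y\<close> uniform on \<open>{0, 2}\<close> (take \<open>f = 0\<close> on \<open>[0, 1)\<close> and \<open>f x = 4 + x\<close>
  on \<open>[1, \<infinity>)\<close>), so \<open>D\<^sub>f\<close> is defined as the infimum. It is the minimum whenever there is one.
\<close>

definition D\<^sub>f :: "(real \<Rightarrow> real) \<Rightarrow> 'a measure \<Rightarrow> ('a \<Rightarrow> real) \<Rightarrow> ennreal" where
  "D\<^sub>f f M Y = (INF a. expected_loss f M Y a)"

lemma D\<^sub>f_eq_min:
  assumes "\<And>b. expected_loss f M Y a \<le> expected_loss f M Y b"
  shows "D\<^sub>f f M Y = expected_loss f M Y a"
  unfolding D\<^sub>f_def by (intro antisym INF_lower INF_greatest assms UNIV_I)

definition finitely_supported_on_ints :: "'a measure \<Rightarrow> ('a \<Rightarrow> real) \<Rightarrow> bool" where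
  "finitely_supported_on_ints M X \<longleftrightarrow>
     (\<exists>S::int set. finite S \<and> (AE \<omega> in M. X \<omega> \<in> of_int ` S))"

definition prob_at :: "'a measure \<Rightarrow> ('a \<Rightarrow> real) \<Rightarrow> int \<Rightarrow> real" where
  "prob_at M X k = measure M {\<omega> \<in> space M. X \<omega> = of_int k}"

definition int_atoms :: "'a measure \<Rightarrow> ('a \<Rightarrow> real) \<Rightarrow> int set" where
  "int_atoms M X = {k. prob_at M X k > 0}"

definition sorted_probs :: "'a measure \<Rightarrow> ('a \<Rightarrow> real) \<Rightarrow> real list" where
  "sorted_probs M X = rev (sort (map (prob_at M X) (sorted_list_of_set (int_atoms M X))))"

definition rearr_pos :: "nat \<Rightarrow> int" where
  "rearr_pos i = (-1) ^ i * int (i div 2)"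

text \<open>
  \<open>X\<^sup>+\<close> is determined only in distribution: \<open>is_rearrangement M X N Y\<close> says that the variable \<open>Y\<close>, on a
  possibly different probability space \<open>N\<close>, has the distribution of \<open>X\<^sup>+\<close>. The prescribed point masses
  sum to \<open>1\<close>, so they fix that distribution. Lists are indexed from \<open>0\<close>, hence \<open>i - 1\<close>.
\<close>

definition is_rearrangement ::
    "'a measure \<Rightarrow> ('a \<Rightarrow> real) \<Rightarrow> 'b measure \<Rightarrow> ('b \<Rightarrow> real) \<Rightarrow> bool" where
  "is_rearrangement M X N Y \<longleftrightarrow>
     prob_space N \<and> Y \<in> borel_measurable N \<and>
     (\<forall>i \<in> {1..length (sorted_probs M X)}.
        prob_at N Y (rearr_pos i) = sorted_probs M X ! (i - 1))"

definition same_distr :: "'a measure \<Rightarrow> ('a \<Rightarrow> real) \<Rightarrow> 'b measure \<Rightarrow> ('b \<Rightarrow> real) \<Rightarrow> bool" where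
  "same_distr M X N Y \<longleftrightarrow> distr M borel X = distr N borel Y"

lemma inj_rearr_pos: "inj_on rearr_pos {1..}"
proof (rule inj_onI)
  fix i j :: nat
  assume "i \<in> {1..}" "j \<in> {1..}" and eq: "rearr_pos i = rearr_pos j"
  then have "i \<ge> 1" "j \<ge> 1" by auto
  with eq show "i = j"
    by (cases "even i"; cases "even j"; auto simp: rearr_pos_def elim!: evenE oddE)
qed

lemma int_atoms_finite_sum:
  assumes "prob_space M" "X \<in> borel_measurable M" "finitely_supported_on_ints M X"
  shows "finite (int_atoms M X)" "(\<Sum>k\<in>int_atoms M X. prob_at M X k) = 1"
proof -
  interpret prob_space M by fact
  note [measurable] = assms(2)
  obtain S :: "int set" where S: "finite S" "AE \<omega> in M. X \<omega> \<in> of_int ` S"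
    using assms(3) by (auto simp: finitely_supported_on_ints_def)
  have zero: "prob_at M X k = 0" if "k \<notin> S" for k
    unfolding prob_at_def
  proof (rule prob_eq_0[THEN iffD2])
    show "AE \<omega> in M. \<omega> \<notin> {\<omega> \<in> space M. X \<omega> = of_int k}"
      by (rule AE_mp[OF S(2)]) (use that in auto)
  qed measurable
  have sub: "int_atoms M X \<subseteq> S"
    using zero by (force simp: int_atoms_def)
  then show "finite (int_atoms M X)" using S(1) finite_subset by blast
  have "(\<Sum>k\<in>int_atoms M X. prob_at M X k) = (\<Sum>k\<in>S. prob_at M X k)"
    by (rule sum.mono_neutral_left[OF S(1) sub])
      (auto simp: int_atoms_def prob_at_def not_less measure_le_0_iff)
  also have "\<dots> = prob (\<Union>k\<in>S. {\<omega> \<in> space M. X \<omega> = of_int k})"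
    unfolding prob_at_def
    by (rule finite_measure_finite_Union[symmetric, OF S(1)])
      (auto simp: disjoint_family_on_def)
  also have "\<dots> = 1"
  proof (rule prob_eq_1[THEN iffD2])
    show "AE \<omega> in M. \<omega> \<in> (\<Union>k\<in>S. {\<omega> \<in> space M. X \<omega> = of_int k})"
      by (rule AE_mp[OF S(2)]) auto
  qed (use S(1) in measurable)
  finally show "(\<Sum>k\<in>int_atoms M X. prob_at M X k) = 1" .
qed

lemma is_rearrangement_exists:
  assumes "prob_space M" "X \<in> borel_measurable M" "finitely_supported_on_ints M X"
  shows "\<exists>p. is_rearrangement M X (measure_pmf p) real_of_int"
proof -
  define ps where "ps = sorted_probs M X"
  define xs where "xs = map (\<lambda>i. (rearr_pos (Suc i), ps ! i)) [0..<length ps]"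
  have fin: "finite (int_atoms M X)" by (rule int_atoms_finite_sum[OF assms])
  have snd_xs: "map snd xs = ps"
    by (simp add: xs_def comp_def map_nth)
  have "sum_list ps = sum_list (map (prob_at M X) (sorted_list_of_set (int_atoms M X)))"
    by (simp add: ps_def sorted_probs_def flip: sum_mset_sum_list)
  also have "\<dots> = (\<Sum>k\<in>int_atoms M X. prob_at M X k)"
    using fin by (simp add: sum_list_distinct_conv_sum_set)
  finally have sum1: "sum_list ps = 1"
    by (simp only: int_atoms_finite_sum[OF assms])
  have nonneg: "x \<ge> 0" if "x \<in> set ps" for x
    using that fin by (auto simp: ps_def sorted_probs_def prob_at_def)
  have wf: "pmf_of_list_wf xs"
    unfolding pmf_of_list_wf_def snd_xs using nonneg sum1 by blast
  have "map fst xs = map (rearr_pos \<circ> Suc) [0..<length ps]" by (simp add: xs_def comp_def)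
  moreover have "inj_on (rearr_pos \<circ> Suc) (set [0..<length ps])"
    using inj_rearr_pos by (auto simp: inj_on_def)
  ultimately have dist: "distinct (map fst xs)"
    by (simp add: distinct_map)
  have pmf: "pmf (pmf_of_list xs) (rearr_pos i) = ps ! (i - 1)" if "i \<in> {1..length ps}" for i
  proof -
    have "(rearr_pos i, ps ! (i - 1)) \<in> set xs"
      using that by (auto simp: xs_def intro!: image_eqI[of _ _ "i - 1"])
    then have "filter (\<lambda>z. fst z = rearr_pos i) xs = [(rearr_pos i, ps ! (i - 1))]"
      using dist
    proof (induction xs)
      case (Cons z zs)
      show ?case
      proof (cases "z = (rearr_pos i, ps ! (i - 1))")
        case True
        then have "filter (\<lambda>z. fst z = rearr_pos i) zs = []"
          using Cons.prems by (force simp: filter_empty_conv)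
        then show ?thesis using True by simp
      next
        case False
        then have m: "(rearr_pos i, ps ! (i - 1)) \<in> set zs" using Cons.prems by auto
        then have "fst z \<noteq> rearr_pos i" using Cons.prems by force
        then show ?thesis using Cons.IH[OF m] Cons.prems by simp
      qed
    qed simp
    then show ?thesis by (simp add: pmf_pmf_of_list[OF wf])
  qed
  have "is_rearrangement M X (measure_pmf (pmf_of_list xs)) real_of_int"
    using pmf unfolding is_rearrangement_def ps_def[symmetric]
    by (auto simp: prob_at_def measure_pmf.prob_space_axioms measure_pmf_single)
  then show ?thesis ..
qed

end

theory Submission
  imports Defs
begin

text \<open>
  Write \<open>a = k \<plusminus> t\<close> with \<open>k\<close> an integer nearest to \<open>a\<close> and \<open>0 \<le> t \<le> 1/2\<close>. Listing the integers as
  \<open>k, k \<plusminus> 1, k \<mp> 1, k \<plusminus> 2, \<dots>\<close> orders them by their distance to \<open>a\<close>, and these are the distances of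
  \<open>0, 1, -1, 2, \<dots>\<close> to \<open>t\<close>. By the rearrangement inequality the loss of \<open>X\<close> at \<open>a\<close> is therefore at
  least the loss of \<open>X\<^sup>+\<close> at \<open>t\<close>.

  If the two minima agree, take for \<open>a\<close> a minimiser for \<open>X\<close>; then \<open>t\<close> is a minimiser for \<open>X\<^sup>+\<close> and the
  rearrangement inequality is an equality. For \<open>0 < t < 1/2\<close> the distances are distinct, so the weights
  of \<open>X\<close> are already in sorted order. For \<open>t \<in> {0, 1/2}\<close> the distances tie in pairs, but the
  vanishing derivative of the loss of \<open>X\<^sup>+\<close> at \<open>t\<close> forces the sorted weights on each pair to be equal,
  so that the order within the pair does not matter.
\<close>

subsection \<open>Variables with finitely many integer values\<close>

text \<open>A rearrangement is known only through its point masses, so its support is recovered from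
  the fact that these masses exhaust the total mass 1.\<close>

lemma AE_in_int_set:
  assumes "prob_space M" and [measurable]: "X \<in> borel_measurable M"
    and "finite T" and "(\<Sum>k\<in>T. prob_at M X k) = 1"
  shows "AE \<omega> in M. X \<omega> \<in> of_int ` T"
proof -
  interpret prob_space M by fact
  have "prob (\<Union>k\<in>T. {\<omega> \<in> space M. X \<omega> = of_int k}) = (\<Sum>k\<in>T. prob_at M X k)"
    unfolding prob_at_def
    by (rule finite_measure_finite_Union) (use assms(3) in \<open>auto simp: disjoint_family_on_def\<close>)
  then have "prob (\<Union>k\<in>T. {\<omega> \<in> space M. X \<omega> = of_int k}) = 1"
    using assms by simp
  then have "AE \<omega> in M. \<omega> \<in> (\<Union>k\<in>T. {\<omega> \<in> space M. X \<omega> = of_int k})"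
    using prob_eq_1[of "\<Union>k\<in>T. {\<omega> \<in> space M. X \<omega> = of_int k}"] assms(3) by auto
  then show ?thesis
    by (rule AE_mp) auto
qed

lemma nn_integral_int_valued:
  fixes g :: "real \<Rightarrow> ennreal"
  assumes "prob_space M" and [measurable]: "X \<in> borel_measurable M"
    and "finite T" and "(\<Sum>k\<in>T. prob_at M X k) = 1"
  shows "(\<integral>\<^sup>+ \<omega>. g (X \<omega>) \<partial>M) = (\<Sum>k\<in>T. g (of_int k) * ennreal (prob_at M X k))"
proof -
  interpret prob_space M by fact
  define B where "B k = {\<omega> \<in> space M. X \<omega> = of_int k}" for k :: int
  have [measurable]: "B k \<in> sets M" for k
    unfolding B_def by measurable
  have "(\<integral>\<^sup>+ \<omega>. g (X \<omega>) \<partial>M) = (\<integral>\<^sup>+ \<omega>. (\<Sum>k\<in>T. g (of_int k) * indicator (B k) \<omega>) \<partial>M)"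
  proof (rule nn_integral_cong_AE, rule AE_mp[OF AE_in_int_set[OF assms]], rule AE_I2, rule impI)
    fix \<omega> assume \<omega>: "\<omega> \<in> space M" "X \<omega> \<in> of_int ` T"
    then obtain m where m: "m \<in> T" "X \<omega> = of_int m" by auto
    have "(\<Sum>k\<in>T. g (of_int k) * indicator (B k) \<omega>) = (\<Sum>k\<in>T. if k = m then g (of_int m) else 0)"
      by (rule sum.cong) (use \<omega> m in \<open>auto simp: B_def indicator_def\<close>)
    also have "\<dots> = g (X \<omega>)"
      using m assms(3) by simp
    finally show "g (X \<omega>) = (\<Sum>k\<in>T. g (of_int k) * indicator (B k) \<omega>)" ..
  qed
  also have "\<dots> = (\<Sum>k\<in>T. g (of_int k) * emeasure M (B k))"
    by (simp add: nn_integral_sum nn_integral_cmult_indicator)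
  also have "\<dots> = (\<Sum>k\<in>T. g (of_int k) * ennreal (prob_at M X k))"
    by (simp add: prob_at_def B_def emeasure_eq_measure)
  finally show ?thesis .
qed

lemma expected_loss_int_valued:
  assumes "prob_space M" "X \<in> borel_measurable M"
    and "finite T" "(\<Sum>k\<in>T. prob_at M X k) = 1" and "\<forall>x\<ge>0. f x \<ge> 0"
  shows "expected_loss f M X a = ennreal (\<Sum>k\<in>T. prob_at M X k * f \<bar>of_int k - a\<bar>)"
proof -
  have "expected_loss f M X a = (\<Sum>k\<in>T. ennreal (f \<bar>of_int k - a\<bar>) * ennreal (prob_at M X k))"
    unfolding expected_loss_def by (rule nn_integral_int_valued[OF assms(1-4)])
  also have "\<dots> = (\<Sum>k\<in>T. ennreal (prob_at M X k * f \<bar>of_int k - a\<bar>))"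
    using assms(5) by (intro sum.cong) (auto simp: ennreal_mult prob_at_def mult.commute)
  also have "\<dots> = ennreal (\<Sum>k\<in>T. prob_at M X k * f \<bar>of_int k - a\<bar>)"
    using assms(5) by (intro sum_ennreal) (auto simp: prob_at_def)
  finally show ?thesis .
qed

lemma emeasure_distr_int_valued:
  assumes "prob_space M" and [measurable]: "X \<in> borel_measurable M"
    and "finite T" and "(\<Sum>k\<in>T. prob_at M X k) = 1" and [measurable]: "A \<in> sets borel"
  shows "emeasure (distr M borel X) A
    = (\<Sum>k\<in>T. indicator A (real_of_int k) * ennreal (prob_at M X k))"
proof -
  have "emeasure (distr M borel X) A = (\<integral>\<^sup>+ x. indicator A x \<partial>distr M borel X)"
    by simp
  also have "\<dots> = (\<integral>\<^sup>+ \<omega>. indicator A (X \<omega>) \<partial>M)"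
    by (rule nn_integral_distr) auto
  finally show ?thesis
    using nn_integral_int_valued[OF assms(1-4), of "indicator A"] by simp
qed

text \<open>On \<open>T\<close> the masses of \<open>Y\<close> agree with those of \<open>X\<close>,
  so they also sum to 1. Both variables therefore lie in \<open>T\<close> almost surely, and the
  masses there determine both distributions.\<close>

lemma same_distr_int_valuedI:
  assumes "prob_space M" "X \<in> borel_measurable M" "prob_space N" "Y \<in> borel_measurable N"
    and "finite T" "(\<Sum>k\<in>T. prob_at M X k) = 1"
    and eq: "\<And>k. k \<in> T \<Longrightarrow> prob_at M X k = prob_at N Y k"
  shows "same_distr M X N Y"
  unfolding same_distr_def
proof (rule measure_eqI)
  fix A assume "A \<in> sets (distr M borel X)"
  then have A: "A \<in> sets borel" by simp
  have "(\<Sum>k\<in>T. prob_at N Y k) = 1"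
    using assms(6) eq by simp
  then show "emeasure (distr M borel X) A = emeasure (distr N borel Y) A"
    using eq by (simp add: emeasure_distr_int_valued[OF assms(1,2,5,6) A]
        emeasure_distr_int_valued[OF assms(3,4,5) _ A])
qed simp

subsection \<open>Rearrangement of sequences\<close>

text \<open>The index set is built by adding a new largest element \<open>b\<close>. It has all of
  \<open>A\<close> below it, so \<open>card A \<le> b\<close> and
  \<open>s b \<le> s (card A)\<close>: each step adds no more on the left than on the right.\<close>

lemma sum_antimono_le_initial:
  fixes s :: "nat \<Rightarrow> real"
  assumes "antimono s" "finite I"
  shows "sum s I \<le> sum s {..<card I}"
  using assms(2)
proof (induction I rule: finite_linorder_max_induct)
  case (insert b A)
  then have "card A \<le> card {..<b}"
    by (intro card_mono) auto
  then have "s b \<le> s (card A)"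
    using assms(1) by (simp add: antimono_def)
  then show ?case
    using insert by auto
qed simp

text \<open>Abel summation, written with the boundary value \<open>c n\<close>, one beyond the last
  index summed.\<close>

lemma sum_by_parts_lessThan:
  fixes c d :: "nat \<Rightarrow> real"
  shows "(\<Sum>i<n. d i * c i) = c n * sum d {..<n} - (\<Sum>i<n. (c (Suc i) - c i) * sum d {..<Suc i})"
  by (induction n) (simp_all add: algebra_simps)

text \<open>Abel summation for \<open>q - s\<close>, where the boundary term vanishes because the
  totals agree. If \<open>c\<close> is monotone and the initial sums of \<open>s\<close> dominate,
  every term on the right is non-negative. This gives the inequality, and in the case of equality it
  forces the initial sums to agree at every jump of \<open>c\<close>.\<close>

lemma rearrangement_sum_diff:
  fixes c q s :: "nat \<Rightarrow> real"
  assumes "sum q {..<n} = sum s {..<n}"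
  shows "(\<Sum>i<n. q i * c i) - (\<Sum>i<n. s i * c i) =
    (\<Sum>i<n. (c (Suc i) - c i) * (sum s {..<Suc i} - sum q {..<Suc i}))"
  using sum_by_parts_lessThan[of "\<lambda>i. q i - s i" c n] assms
  by (simp add: algebra_simps sum_subtractf sum.distrib sum_negf)

lemma rearrangement_le:
  fixes c q s :: "nat \<Rightarrow> real"
  assumes "mono c" "\<And>n. sum q {..<n} \<le> sum s {..<n}" "sum q {..<n} = sum s {..<n}"
  shows "(\<Sum>i<n. s i * c i) \<le> (\<Sum>i<n. q i * c i)"
proof -
  have "0 \<le> (\<Sum>i<n. (c (Suc i) - c i) * (sum s {..<Suc i} - sum q {..<Suc i}))"
    using assms(1) assms(2)[of "Suc _"]
    by (intro sum_nonneg mult_nonneg_nonneg) (auto simp: mono_iff_le_Suc simp del: sum.lessThan_Suc)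
  then show ?thesis
    using rearrangement_sum_diff[OF assms(3), of c] by linarith
qed

lemma rearrangement_eq_initial_sum:
  fixes c q s :: "nat \<Rightarrow> real"
  assumes "mono c" "\<And>n. sum q {..<n} \<le> sum s {..<n}" "sum q {..<n} = sum s {..<n}"
    and "(\<Sum>i<n. s i * c i) = (\<Sum>i<n. q i * c i)"
    and "m < n" "c m < c (Suc m)"
  shows "sum q {..<Suc m} = sum s {..<Suc m}"
proof -
  have nn: "\<forall>i\<in>{..<n}. 0 \<le> (c (Suc i) - c i) * (sum s {..<Suc i} - sum q {..<Suc i})"
    using assms(1) assms(2)[of "Suc _"]
    by (intro ballI mult_nonneg_nonneg) (auto simp: mono_iff_le_Suc simp del: sum.lessThan_Suc)
  have "(\<Sum>i<n. (c (Suc i) - c i) * (sum s {..<Suc i} - sum q {..<Suc i})) = 0"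
    using rearrangement_sum_diff[OF assms(3), of c] assms(4) by linarith
  then have "(c (Suc m) - c m) * (sum s {..<Suc m} - sum q {..<Suc m}) = 0"
    using sum_nonneg_eq_0_iff[of "{..<n}"
        "\<lambda>i. (c (Suc i) - c i) * (sum s {..<Suc i} - sum q {..<Suc i})"] nn assms(5) by blast
  then show ?thesis
    using assms(6) by auto
qed

text \<open>
  If \<open>c\<close> has a tie at \<open>m, Suc m\<close>, the initial sums agree just before and just after the pair. The
  greatest-sum property bounds \<open>q m\<close> and \<open>q (Suc m)\<close> by the common value of \<open>s\<close> on the pair, and
  then both bounds are equalities.
\<close>

lemma rearrangement_eqD:
  fixes c q s :: "nat \<Rightarrow> real"
  assumes "mono c"
    and greatest: "\<And>A. finite A \<Longrightarrow> sum q A \<le> sum s {..<card A}"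
    and total: "\<And>n. n \<ge> n0 \<Longrightarrow> sum q {..<n} = sum s {..<n}"
    and eq: "\<And>n. n \<ge> n0 \<Longrightarrow> (\<Sum>i<n. s i * c i) = (\<Sum>i<n. q i * c i)"
    and no_triple: "\<And>m. c m < c (Suc m) \<or> c (Suc m) < c (Suc (Suc m))"
    and tie: "\<And>m. c m = c (Suc m) \<Longrightarrow> s m = s (Suc m)"
  shows "q i = s i"
proof -
  have le: "sum q {..<n} \<le> sum s {..<n}" for n
    using greatest[of "{..<n}"] by simp
  \<comment> \<open>The length \<open>max n0 (Suc m)\<close> lies beyond \<open>m\<close> and is
    large enough for \<open>total\<close> and \<open>eq\<close>.\<close>
  have strict: "sum q {..<Suc m} = sum s {..<Suc m}" if "c m < c (Suc m)" for m
    by (rule rearrangement_eq_initial_sum[OF assms(1) le, of "max n0 (Suc m)" m])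
      (use total eq that in \<open>auto simp del: sum.lessThan_Suc\<close>)
  have all: "sum q {..<n} = sum s {..<n}" for n
  proof (cases n)
    case (Suc m)
    show ?thesis
    proof (cases "c m < c (Suc m)")
      case True
      then show ?thesis using strict Suc by simp
    next
      case False
      then have ctie: "c m = c (Suc m)"
        using assms(1) by (simp add: mono_iff_le_Suc order_antisym not_less)
      then have s: "s m = s (Suc m)" by (rule tie)
      have after: "sum q {..<Suc (Suc m)} = sum s {..<Suc (Suc m)}"
        using no_triple[of m] False strict by blast
      have before: "sum q {..<m} = sum s {..<m}"
      proof (cases m)
        case (Suc m')
        then show ?thesis using no_triple[of m'] ctie strict[of m'] by auto
      qed simp
      \<comment> \<open>Exchanging \<open>m\<close> for \<open>Suc m\<close> keeps the cardinality
        \<open>Suc m\<close>. The set is not an initial segment, which is why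
        \<open>greatest\<close> is stated for arbitrary finite sets.\<close>
      have "sum q (insert (Suc m) {..<m}) \<le> sum s {..<Suc m}"
        using greatest[of "insert (Suc m) {..<m}"] by simp
      then have "q (Suc m) \<le> s m"
        using before by simp
      moreover have "q m \<le> s m"
        using le[of "Suc m"] before by simp
      ultimately show ?thesis
        using after before s Suc by simp
    qed
  qed simp
  show ?thesis
    using all[of i] all[of "Suc i"] by simp
qed

text \<open>The last property is the sense in which \<open>s\<close> dominates: any \<open>n\<close>
  integers together carry at most the \<open>n\<close> largest masses. It bounds the weights of
  \<open>X\<close> along every enumeration of the integers.\<close>

lemma rearrangement_masses:
  assumes "prob_space M" "X \<in> borel_measurable M" "finitely_supported_on_ints M X"
  obtains s where "antimono s" "\<And>i. i \<ge> length (sorted_probs M X) \<Longrightarrow> s i = 0"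
    "\<And>i. i < length (sorted_probs M X) \<Longrightarrow> s i = sorted_probs M X ! i"
    "sum s {..<length (sorted_probs M X)} = 1"
    "\<And>A. finite A \<Longrightarrow> sum (prob_at M X) A \<le> sum s {..<card A}"
proof -
  define p where "p = prob_at M X"
  \<comment> \<open>Sorting the atoms, and not only their masses, turns sets of integers into sets
    of list positions.\<close>
  define zs where "zs = rev (sort_key p (sorted_list_of_set (int_atoms M X)))"
  \<comment> \<open>The default 0 keeps \<open>s\<close> non-increasing, since masses are
    non-negative, and lets sums run past the end of the list.\<close>
  define s where "s i = (if i < length zs then p (zs ! i) else 0)" for i
  note fin = int_atoms_finite_sum[OF assms]
  have p0: "p k \<ge> 0" for k by (simp add: p_def prob_at_def)
  have zs: "distinct zs" "set zs = int_atoms M X"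
    using fin by (auto simp: zs_def)
  have "sort (map p (sorted_list_of_set (int_atoms M X)))
      = map p (sort_key p (sorted_list_of_set (int_atoms M X)))"
    by (rule properties_for_sort) simp_all
  then have ps: "sorted_probs M X = map p zs"
    by (simp add: sorted_probs_def zs_def rev_map p_def)
  have "sorted (rev (map p zs))"
    by (simp add: zs_def rev_map)
  then have "p (zs ! j) \<le> p (zs ! i)" if "i \<le> j" "j < length zs" for i j
    using sorted_rev_nth_mono[of "map p zs" i j] that by simp
  then have anti: "antimono s"
    by (auto simp: antimono_def s_def p0)
  have s0: "s i \<ge> 0" for i by (simp add: s_def p0)
  have bij: "bij_betw ((!) zs) {..<length zs} (int_atoms M X)"
    using bij_betw_nth[OF zs(1)] zs(2) by blast
  show ?thesis
  proof (rule that[OF anti])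
    show "s i = 0" if "i \<ge> length (sorted_probs M X)" for i
      using that by (simp add: ps s_def)
    show "s i = sorted_probs M X ! i" if "i < length (sorted_probs M X)" for i
      using that by (simp add: ps s_def)
    have "sum s {..<length zs} = sum p (int_atoms M X)"
      using sum.reindex_bij_betw[OF bij, of p] by (simp add: s_def)
    then show "sum s {..<length (sorted_probs M X)} = 1"
      using fin by (simp add: ps p_def)
    fix A :: "int set" assume A: "finite A"
    define I where "I = {i \<in> {..<length zs}. zs ! i \<in> A}"
    have b: "bij_betw ((!) zs) I (A \<inter> int_atoms M X)"
      using bij by (auto simp: I_def bij_betw_def intro: inj_on_subset)
    have finI: "finite I" by (simp add: I_def)
    have "sum p A = sum p (A \<inter> int_atoms M X)"
      using A p0 by (intro sum.mono_neutral_right)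
        (auto simp: int_atoms_def p_def order_antisym not_less)
    also have "\<dots> = (\<Sum>i\<in>I. p (zs ! i))"
      by (rule sum.reindex_bij_betw[OF b, symmetric])
    also have "\<dots> = sum s I"
      by (rule sum.cong) (auto simp: s_def I_def)
    also have "\<dots> \<le> sum s {..<card I}"
      by (rule sum_antimono_le_initial[OF anti finI])
    also have "\<dots> \<le> sum s {..<card A}"
    proof (rule sum_mono2)
      have "card I = card (A \<inter> int_atoms M X)" by (rule bij_betw_same_card[OF b])
      also have "\<dots> \<le> card A" using A by (intro card_mono) auto
      finally show "{..<card I} \<subseteq> {..<card A}" by simp
    qed (auto simp: s0)
    finally show "sum (prob_at M X) A \<le> sum s {..<card A}"
      by (simp add: p_def)
  qed
qed

subsection \<open>The zigzag enumeration of the integers\<close>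

text \<open>Shifted by one because \<open>rearr_pos 0\<close> and \<open>rearr_pos 1\<close> are
  both 0; the values 0, 1, -1, 2, ... then meet each integer exactly once.\<close>

definition zigzag :: "nat \<Rightarrow> int" where
  "zigzag i = rearr_pos (Suc i)"

lemma zigzag_double: "zigzag (2 * j) = - int j"
  by (simp add: zigzag_def rearr_pos_def)

lemma zigzag_Suc_double: "zigzag (Suc (2 * j)) = int j + 1"
  by (simp add: zigzag_def rearr_pos_def)

lemma nat_double_cases:
  fixes i :: nat
  obtains (even) j where "i = 2 * j" | (odd) j where "i = Suc (2 * j)"
  by (metis evenE oddE Suc_eq_plus1)

lemma bij_zigzag: "bij zigzag"
proof (rule bijI)
  show "inj zigzag"
    using inj_rearr_pos by (auto simp: inj_on_def zigzag_def)
  have "k \<in> range zigzag" for k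
  proof (cases "k \<le> 0")
    case True
    then have "k = zigzag (2 * nat (- k))" by (simp add: zigzag_double)
    then show ?thesis by blast
  next
    case False
    then have "k = zigzag (Suc (2 * nat (k - 1)))" by (simp add: zigzag_Suc_double)
    then show ?thesis by blast
  qed
  then show "surj zigzag" by blast
qed

lemma bij_signed_zigzag:
  assumes "\<sigma> \<in> {1, - 1}"
  shows "bij (\<lambda>i. k + \<sigma> * zigzag i)"
proof -
  have "bij (\<lambda>x. k + \<sigma> * x)"
    by (rule o_bij[of "\<lambda>y. \<sigma> * (y - k)"]) (use assms in \<open>auto simp: fun_eq_iff\<close>)
  from bij_comp[OF bij_zigzag this] show ?thesis by (simp add: comp_def)
qed

lemma zigzag_dist_double: "0 \<le> t \<Longrightarrow> \<bar>real_of_int (zigzag (2 * j)) - t\<bar> = real j + t"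
  by (simp add: zigzag_double)

lemma zigzag_dist_Suc_double:
  "t \<le> 1/2 \<Longrightarrow> \<bar>real_of_int (zigzag (Suc (2 * j))) - t\<bar> = real j + 1 - t"
  by (simp add: zigzag_Suc_double)

lemma zigzag_dist_Suc_Suc_double:
  "0 \<le> t \<Longrightarrow> \<bar>real_of_int (zigzag (Suc (Suc (2 * j)))) - t\<bar> = real j + 1 + t"
  using zigzag_dist_double[of t "Suc j"] by simp

text \<open>The distances to \<open>t\<close> run \<open>t\<close>, \<open>1 - t\<close>,
  \<open>1 + t\<close>, \<open>2 - t\<close>, ..., with gaps alternately \<open>1 - 2 * t\<close>
  and \<open>2 * t\<close>, both non-negative.\<close>

lemma zigzag_dist_le_Suc:
  assumes "0 \<le> t" "t \<le> 1/2"
  shows "\<bar>real_of_int (zigzag i) - t\<bar> \<le> \<bar>real_of_int (zigzag (Suc i)) - t\<bar>"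
  by (rule nat_double_cases[of i])
    (use assms in \<open>auto simp: zigzag_dist_double zigzag_dist_Suc_double zigzag_dist_Suc_Suc_double\<close>)

text \<open>The alternating gaps \<open>1 - 2 * t\<close> and \<open>2 * t\<close> cannot both be
  0.\<close>

lemma zigzag_dist_no_triple:
  assumes "0 \<le> t" "t \<le> 1/2"
  shows "\<bar>real_of_int (zigzag i) - t\<bar> < \<bar>real_of_int (zigzag (Suc i)) - t\<bar> \<or>
    \<bar>real_of_int (zigzag (Suc i)) - t\<bar> < \<bar>real_of_int (zigzag (Suc (Suc i))) - t\<bar>"
proof (rule nat_double_cases[of i])
  fix j assume "i = Suc (2 * j)"
  then show ?thesis
    using assms zigzag_dist_Suc_double[of t "Suc j"]
    by (auto simp: zigzag_dist_Suc_double zigzag_dist_Suc_Suc_double)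
qed (use assms in \<open>auto simp: zigzag_dist_double zigzag_dist_Suc_double zigzag_dist_Suc_Suc_double\<close>)

lemma zigzag_dist_tie:
  assumes "0 \<le> t" "t \<le> 1/2"
    and "\<bar>real_of_int (zigzag i) - t\<bar> = \<bar>real_of_int (zigzag (Suc i)) - t\<bar>"
  obtains j where "t = 0" "i = Suc (2 * j)" | j where "t = 1/2" "i = 2 * j"
  by (rule nat_double_cases[of i])
    (use assms in \<open>auto simp: zigzag_dist_double zigzag_dist_Suc_double zigzag_dist_Suc_Suc_double\<close>)

text \<open>The bound \<open>n0\<close> exceeds every index that hits \<open>T\<close>, so it is
  independent of \<open>g\<close> and serves the loss and the total mass at once.\<close>

lemma sum_eq_enumeration:
  fixes p :: "'b \<Rightarrow> real" and \<phi> :: "nat \<Rightarrow> 'b"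
  assumes "bij \<phi>" "finite T" "\<And>x. x \<notin> T \<Longrightarrow> p x = 0"
  obtains n0 where "\<And>n g. n \<ge> n0 \<Longrightarrow> (\<Sum>x\<in>T. p x * g x) = (\<Sum>i<n. p (\<phi> i) * g (\<phi> i))"
proof -
  have "finite (\<phi> -` T)"
    using assms by (intro finite_vimageI) (auto simp: bij_def)
  then obtain n0 where n0: "\<phi> -` T \<subseteq> {..<n0}"
    using finite_nat_iff_bounded by blast
  show ?thesis
  proof (rule that)
    fix n and g :: "'b \<Rightarrow> real" assume "n \<ge> n0"
    then have "T \<subseteq> \<phi> ` {..<n}"
      using n0 assms(1) by (force simp: bij_def surj_def)
    then have "(\<Sum>x\<in>T. p x * g x) = (\<Sum>x\<in>\<phi> ` {..<n}. p x * g x)"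
      using assms by (intro sum.mono_neutral_left) auto
    also have "\<dots> = (\<Sum>i<n. p (\<phi> i) * g (\<phi> i))"
      using assms(1) by (subst sum.reindex) (auto simp: bij_def intro: inj_on_subset)
    finally show "(\<Sum>x\<in>T. p x * g x) = (\<Sum>i<n. p (\<phi> i) * g (\<phi> i))" .
  qed
qed

subsection \<open>The expected loss near a minimiser\<close>

text \<open>At 0 the left difference quotient is the negative of the right one, and both tend to 0
  because the right derivative is 0. As \<open>sgn 0 = 0\<close>, the formula gives 0 there whatever
  value \<open>deriv f 0\<close> has.\<close>

lemma DERIV_comp_abs:
  fixes f :: "real \<Rightarrow> real"
  assumes "\<forall>x>0. f differentiable (at x)" "(f has_real_derivative 0) (at_right 0)"
  shows "((\<lambda>x. f \<bar>x\<bar>) has_real_derivative sgn x * deriv f \<bar>x\<bar>) (at x)"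
proof -
  have f: "(f has_real_derivative deriv f y) (at y)" if "y > 0" for y
    using assms(1) that by (simp add: DERIV_deriv_iff_real_differentiable)
  consider "x > 0" | "x < 0" | "x = 0" by linarith
  then show ?thesis
  proof cases
    case 1
    have "((\<lambda>x. f \<bar>x\<bar>) has_real_derivative deriv f x) (at x)"
      by (rule has_field_derivative_transform_within_open[OF f[OF 1], of "{0<..}"])
        (use 1 in auto)
    then show ?thesis using 1 by simp
  next
    case 2
    have "((\<lambda>x. f (- x)) has_real_derivative - deriv f (- x)) (at x)"
      using f[of "- x"] 2 by (simp add: DERIV_mirror)
    then have "((\<lambda>x. f \<bar>x\<bar>) has_real_derivative - deriv f (- x)) (at x)"
      by (rule has_field_derivative_transform_within_open[of _ _ _ "{..<0}"]) (use 2 in auto)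
    then show ?thesis using 2 by simp
  next
    case 3
    have lim: "((\<lambda>y. (f y - f 0) / y) \<longlongrightarrow> 0) (at_right 0)"
      using assms(2) by (simp add: has_field_derivative_iff)
    have r: "((\<lambda>y. (f \<bar>y\<bar> - f 0) / y) \<longlongrightarrow> 0) (at_right 0)"
      by (rule Lim_transform_eventually[OF lim])
        (auto simp: eventually_at_filter)
    have "((\<lambda>y. - ((f y - f 0) / y)) \<longlongrightarrow> 0) (at_right 0)"
      using tendsto_minus[OF lim] by simp
    then have "((\<lambda>y. (f \<bar>- y\<bar> - f 0) / (- y)) \<longlongrightarrow> 0) (at_right 0)"
      by (rule Lim_transform_eventually) (auto simp: eventually_at_filter)
    then have l: "((\<lambda>y. (f \<bar>y\<bar> - f 0) / y) \<longlongrightarrow> 0) (at_left 0)"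
      by (subst filterlim_at_left_to_right) simp
    show ?thesis
      using filterlim_split_at[OF l r] 3 by (simp add: has_field_derivative_iff)
  qed
qed

lemma strict_mono_on_of_deriv_pos:
  fixes f :: "real \<Rightarrow> real"
  assumes "mono_on {0..} f" "\<forall>x>0. f differentiable (at x) \<and> deriv f x > 0"
  shows "strict_mono_on {0..} f"
proof (rule strict_mono_onI)
  fix x y :: real assume xy: "x \<in> {0..}" "y \<in> {0..}" "x < y"
  \<comment> \<open>The derivative is given only at positive points, while \<open>x\<close> may be
    0. The strict increase is taken from the midpoint \<open>z\<close> to \<open>y\<close>.\<close>
  define z where "z = (x + y) / 2"
  have z: "x < z" "z < y" "z > 0" using xy by (auto simp: z_def)
  have "f z < f y"
  proof (rule DERIV_pos_imp_increasing[OF z(2)])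
    fix w assume "z \<le> w" "w \<le> y"
    then show "\<exists>d. DERIV f w :> d \<and> d > 0"
      using assms(2) z(3) by (intro exI[of _ "deriv f w"])
        (auto simp: DERIV_deriv_iff_real_differentiable)
  qed
  moreover have "f x \<le> f z"
    using assms(1) xy z by (auto simp: mono_on_def)
  ultimately show "f x < f y" by simp
qed

text \<open>
  At \<open>t = 0\<close> and \<open>t = 1/2\<close> the points of the zigzag come in pairs symmetric about \<open>t\<close>, the heavier
  weight always on the same side. Hence all contributions to the derivative at \<open>t\<close> have one sign,
  and at a minimiser they all vanish.
\<close>

lemma zigzag_minimiser_tie:
  fixes s :: "nat \<Rightarrow> real"
  assumes "antimono s" and s0: "\<And>i. i \<ge> K \<Longrightarrow> s i = 0"
    and f: "\<forall>x>0. f differentiable (at x) \<and> deriv f x > 0" "(f has_real_derivative 0) (at_right 0)"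
    and t: "0 \<le> t" "t \<le> 1/2"
    and min: "\<And>b. (\<Sum>i<K. s i * f \<bar>real_of_int (zigzag i) - t\<bar>)
      \<le> (\<Sum>i<K. s i * f \<bar>real_of_int (zigzag i) - b\<bar>)"
    and tie: "\<bar>real_of_int (zigzag i) - t\<bar> = \<bar>real_of_int (zigzag (Suc i)) - t\<bar>"
  shows "s i = s (Suc i)"
proof -
  define d where "d x = sgn x * deriv f \<bar>x\<bar>" for x
  have chain: "((\<lambda>b. f \<bar>real_of_int (zigzag i) - b\<bar>) has_real_derivative
      d (real_of_int (zigzag i) - t) * (0 - 1)) (at t)" for i
    unfolding d_def
    by (rule DERIV_chain2[where f = "\<lambda>x. f \<bar>x\<bar>" and g = "\<lambda>b. real_of_int (zigzag i) - b"])
      (use f in \<open>auto intro!: DERIV_comp_abs derivative_eq_intros\<close>)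
  have "((\<lambda>b. \<Sum>i<K. s i * f \<bar>real_of_int (zigzag i) - b\<bar>) has_real_derivative
      (\<Sum>i<K. s i * (d (real_of_int (zigzag i) - t) * (0 - 1)))) (at t)"
    by (intro DERIV_sum DERIV_cmult chain)
  then have "(\<Sum>i<K. s i * (d (real_of_int (zigzag i) - t) * (0 - 1))) = 0"
    by (rule DERIV_local_min[of _ _ _ 1]) (use min in auto)
  then have zK: "(\<Sum>i<K. s i * d (real_of_int (zigzag i) - t)) = 0"
    by (simp add: sum_negf)
  \<comment> \<open>Zero weights allow the sum to be cut at a length of the parity that the pairing
    requires.\<close>
  have z: "(\<Sum>i<n. s i * d (real_of_int (zigzag i) - t)) = 0" if "n \<ge> K" for n
    by (rule trans[OF sum.mono_neutral_right zK]) (use that s0 in auto)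
  have le: "s (Suc i) \<le> s i" for i
    using assms(1) by (simp add: antimono_def)
  from zigzag_dist_tie[OF t tie] show ?thesis
  proof cases
    case (1 j)
    \<comment> \<open>Index 0 is the point 0 itself and contributes \<open>d 0 = 0\<close>. The
      later terms pair \<open>n + 1\<close> with \<open>- (n + 1)\<close>, where \<open>d\<close>
      takes opposite values.\<close>
    have pairs: "(\<Sum>i<Suc (2 * n). s i * d (real_of_int (zigzag i)))
      = (\<Sum>j<n. (s (Suc (2 * j)) - s (Suc (Suc (2 * j)))) * deriv f (real j + 1))" for n
    proof (induction n)
      case 0
      then show ?case using zigzag_double[of 0] by (simp add: d_def)
    next
      case (Suc n)
      have "sgn (- 1 - real n) = - 1" "\<bar>- 1 - real n\<bar> = real n + 1"
        by (auto simp: sgn_if)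
      then have "d (real_of_int (zigzag (Suc (2 * n)))) = deriv f (real n + 1)"
        "d (real_of_int (zigzag (Suc (Suc (2 * n))))) = - deriv f (real n + 1)"
        using zigzag_double[of "Suc n"] by (simp_all add: d_def zigzag_Suc_double)
      then show ?case
        using Suc by (simp add: algebra_simps)
    qed
    \<comment> \<open>The cut-off reaches past all non-zero weights and includes the tied
      pair.\<close>
    have "(\<Sum>j<max K (Suc j). (s (Suc (2 * j)) - s (Suc (Suc (2 * j)))) * deriv f (real j + 1)) = 0"
    proof -
      have "K \<le> Suc (2 * max K (Suc j))" by (simp add: max_def)
      from z[OF this] show ?thesis
        unfolding pairs[symmetric] using 1(1) by simp
    qed
    moreover have "\<forall>j\<in>{..<max K (Suc j)}.
        0 \<le> (s (Suc (2 * j)) - s (Suc (Suc (2 * j)))) * deriv f (real j + 1)"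
      using f(1) le by (intro ballI mult_nonneg_nonneg) (auto intro: less_imp_le)
    ultimately have "(s (Suc (2 * j)) - s (Suc (Suc (2 * j)))) * deriv f (real j + 1) = 0"
      by (subst (asm) sum_nonneg_eq_0_iff) auto
    moreover have "deriv f (real j + 1) > 0" using f(1) by simp
    ultimately show ?thesis using 1 by simp
  next
    case (2 j)
    \<comment> \<open>About \<open>1/2\<close> the pairs are \<open>- n\<close> and
      \<open>n + 1\<close>, so the pairing starts at index 0.\<close>
    have pairs: "(\<Sum>i<2 * n. s i * d (real_of_int (zigzag i) - 1/2))
      = - (\<Sum>j<n. (s (2 * j) - s (Suc (2 * j))) * deriv f (real j + 1/2))" for n
    proof (induction n)
      case (Suc n)
      have "sgn (- real n - 1 / 2) = - 1" "\<bar>- real n - 1 / 2\<bar> = real n + 1 / 2"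
        "sgn (real n + 1 / 2) = 1"
        by (auto simp: sgn_if)
      then have "d (real_of_int (zigzag (2 * n)) - 1/2) = - deriv f (real n + 1/2)"
        "d (real_of_int (zigzag (Suc (2 * n))) - 1/2) = deriv f (real n + 1/2)"
        by (simp_all add: d_def zigzag_double zigzag_Suc_double add.commute)
      then show ?case
        using Suc by (simp add: algebra_simps)
    qed simp
    have "(\<Sum>j<max K (Suc j). (s (2 * j) - s (Suc (2 * j))) * deriv f (real j + 1/2)) = 0"
    proof -
      have "K \<le> 2 * max K (Suc j)" by (simp add: max_def)
      from z[OF this] show ?thesis
        using 2(1) pairs[of "max K (Suc j)"] by simp
    qed
    moreover have "\<forall>j\<in>{..<max K (Suc j)}.
        0 \<le> (s (2 * j) - s (Suc (2 * j))) * deriv f (real j + 1/2)"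
      using f(1) le by (intro ballI mult_nonneg_nonneg) (auto intro!: less_imp_le)
    ultimately have "(s (2 * j) - s (Suc (2 * j))) * deriv f (real j + 1/2) = 0"
      by (subst (asm) sum_nonneg_eq_0_iff) auto
    moreover have "deriv f (real j + 1/2) > 0" using f(1) by simp
    ultimately show ?thesis using 2 by simp
  qed
qed

text \<open>Moving a point outside the interval from \<open>Min T\<close> to \<open>Max T\<close> to
  the nearer endpoint decreases its distance to every atom. The minimum over this compact interval
  is therefore global.\<close>

lemma discrete_loss_attains_min:
  fixes p :: "int \<Rightarrow> real"
  assumes "finite T" "T \<noteq> {}" "\<And>k. p k \<ge> 0" "mono_on {0..} f"
    and cont: "continuous_on UNIV (\<lambda>x::real. f \<bar>x\<bar> :: real)"
  obtains a where "\<And>b. (\<Sum>k\<in>T. p k * f \<bar>of_int k - a\<bar>) \<le> (\<Sum>k\<in>T. p k * f \<bar>of_int k - b\<bar>)"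
proof -
  define L where "L a = (\<Sum>k\<in>T. p k * f \<bar>of_int k - a\<bar>)" for a
  define l u where "l = real_of_int (Min T)" and "u = real_of_int (Max T)"
  have lu: "l \<le> of_int k" "of_int k \<le> u" if "k \<in> T" for k
    using that assms(1) by (auto simp: l_def u_def)
  have "l \<le> u" using assms(2) lu by (meson all_not_in_conv order_trans)
  have "continuous_on {l..u} L"
    unfolding L_def
    by (intro continuous_intros continuous_on_compose2[OF cont]) auto
  then obtain a where a: "\<And>b. b \<in> {l..u} \<Longrightarrow> L a \<le> L b"
    using continuous_attains_inf[of "{l..u}" L] \<open>l \<le> u\<close>
    by (metis atLeastatMost_empty_iff2 compact_Icc)
  have step: "L b \<le> L b'" if "\<And>k. k \<in> T \<Longrightarrow> \<bar>of_int k - b\<bar> \<le> \<bar>of_int k - b'\<bar>" for b b'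
    unfolding L_def using that assms(3,4)
    by (intro sum_mono mult_left_mono) (auto simp: mono_on_def)
  have "L a \<le> L b" for b
  proof -
    consider "b < l" | "b > u" | "b \<in> {l..u}" by fastforce
    then show ?thesis
    proof cases
      case 1
      then have "L l \<le> L b" by (intro step) (use lu in fastforce)
      then show ?thesis using a[of l] \<open>l \<le> u\<close> by simp
    next
      case 2
      then have "L u \<le> L b" by (intro step) (use lu in fastforce)
      then show ?thesis using a[of u] \<open>l \<le> u\<close> by simp
    qed (rule a)
  qed
  then show ?thesis
    unfolding L_def by (rule that)
qed

section \<open>Comparison of the losses of \<open>X\<close> and \<open>Xplus\<close>\<close>

lemma nearest_integer_cases:
  obtains k \<sigma> :: int and t :: real
  where "\<sigma> \<in> {1, - 1}" "0 \<le> t" "t \<le> 1/2" "a = of_int k + of_int \<sigma> * t"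
proof -
  have "\<bar>a - of_int (round a)\<bar> \<le> 1/2"
    using of_int_round_abs_le[of a] by (simp add: abs_minus_commute)
  then show ?thesis
    using that[of 1 "a - round a" "round a"] that[of "- 1" "round a - a" "round a"] by force
qed

theorem theorem1:
  fixes M :: "'a measure" and X :: "'a \<Rightarrow> real"
    and N :: "'b measure" and Xplus :: "'b \<Rightarrow> real"
    and f :: "real \<Rightarrow> real"
  assumes "prob_space M"
    and "X \<in> borel_measurable M"
    and "finitely_supported_on_ints M X"
    and "is_rearrangement M X N Xplus"
    and "\<forall>x\<ge>0. f x \<ge> 0"
    and "mono_on {0..} f"
  shows "D\<^sub>f f N Xplus \<le> D\<^sub>f f M X \<and>
    ((\<forall>x>0. f differentiable (at x) \<and> deriv f x > 0) \<and>
       (f has_real_derivative 0) (at_right 0) \<and>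
       \<not> (\<exists>k::int. same_distr M (\<lambda>\<omega>. X \<omega> - of_int k) N Xplus \<or>
                  same_distr M (\<lambda>\<omega>. X \<omega> - of_int k) N (\<lambda>\<omega>. - Xplus \<omega>))
     \<longrightarrow> D\<^sub>f f N Xplus < D\<^sub>f f M X)"
proof -
  interpret M: prob_space M by fact
  interpret N: prob_space N using assms(4) by (simp add: is_rearrangement_def)
  note [measurable] = assms(2)
  have Y[measurable]: "Xplus \<in> borel_measurable N"
    using assms(4) by (simp add: is_rearrangement_def)
  define T where "T = int_atoms M X"
  define p where "p = prob_at M X"
  define K where "K = length (sorted_probs M X)"
  have T: "finite T" "sum p T = 1"
    using int_atoms_finite_sum[OF assms(1-3)] by (auto simp: T_def p_def)
  have p0: "p k \<ge> 0" for k by (simp add: p_def prob_at_def)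
  have pT: "p k = 0" if "k \<notin> T" for k
    using that p0[of k] by (simp add: T_def int_atoms_def p_def)
  obtain s where s: "antimono s" "\<And>i. i \<ge> K \<Longrightarrow> s i = 0"
    "\<And>i. i < K \<Longrightarrow> s i = sorted_probs M X ! i" "sum s {..<K} = 1"
    "\<And>A. finite A \<Longrightarrow> sum p A \<le> sum s {..<card A}"
    using rearrangement_masses[OF assms(1-3)] unfolding K_def p_def by metis
  have Ys: "prob_at N Xplus (zigzag i) = s i" if "i < K" for i
    using assms(4) s(3)[OF that] that by (auto simp: is_rearrangement_def zigzag_def K_def)
  have inj_zz: "inj_on zigzag A" for A
    using bij_zigzag by (auto simp: bij_def intro: inj_on_subset)
  define L where "L a = (\<Sum>k\<in>T. p k * f \<bar>of_int k - a\<bar>)" for a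
  define F where "F b = (\<Sum>i<K. s i * f \<bar>of_int (zigzag i) - b\<bar>)" for b
  have s_nonneg: "0 \<le> s i" for i
    using antimonoD[OF s(1), of i "max i K"] s(2)[of "max i K"] by simp
  have F_nonneg: "F b \<ge> 0" for b
    unfolding F_def using s_nonneg assms(5) by (intro sum_nonneg mult_nonneg_nonneg) auto
  have ELX: "expected_loss f M X a = ennreal (L a)" for a
    using expected_loss_int_valued[OF assms(1,2) T(1) _ assms(5)] T(2) by (simp add: L_def p_def)
  have sumY: "(\<Sum>k\<in>zigzag ` {..<K}. prob_at N Xplus k) = 1"
    by (subst sum.reindex) (use Ys s(4) in \<open>auto simp: inj_zz\<close>)
  have ELY: "expected_loss f N Xplus b = ennreal (F b)" for b
    unfolding expected_loss_int_valued[OF N.prob_space_axioms Y _ sumY assms(5), simplified] F_def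
    by (subst sum.reindex) (use Ys in \<open>auto simp: inj_zz\<close>)
  \<comment> \<open>Zero weights beyond \<open>K\<close> let \<open>F\<close> be summed to the same
    length as the enumerated loss of \<open>X\<close>.\<close>
  have F_eq: "F b = (\<Sum>i<n. s i * f \<bar>of_int (zigzag i) - b\<bar>)" if "n \<ge> K" for n b
    unfolding F_def by (rule sum.mono_neutral_left) (use that s(2) in auto)
  have s_total: "sum s {..<n} = 1" if "n \<ge> K" for n
    using s(4) by (subst sum.mono_neutral_right[of _ "{..<K}"]) (use that s(2) in auto)
  have cmono: "mono (\<lambda>i. f \<bar>real_of_int (zigzag i) - t\<bar>)" if "0 \<le> t" "t \<le> 1/2" for t
    unfolding mono_iff_le_Suc using zigzag_dist_le_Suc[OF that] assms(6)
    by (auto simp: mono_on_def)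

  \<comment> \<open>The weights \<open>p (k + \<sigma> * zigzag i)\<close> are those of
    \<open>X\<close> listed by distance to \<open>a\<close>. The inequality uses this at every
    \<open>a\<close>, the equality case only at a minimiser.\<close>
  have compare: "\<exists>k \<sigma> t n0. \<sigma> \<in> {1, - 1} \<and> 0 \<le> t \<and> t \<le> 1/2 \<and> n0 \<ge> K \<and>
      (\<forall>n\<ge>n0. L a = (\<Sum>i<n. p (k + \<sigma> * zigzag i) * f \<bar>of_int (zigzag i) - t\<bar>)
        \<and> (\<Sum>i<n. p (k + \<sigma> * zigzag i)) = 1) \<and>
      (\<forall>A. finite A \<longrightarrow> (\<Sum>i\<in>A. p (k + \<sigma> * zigzag i)) \<le> sum s {..<card A})" for a
  proof -
    obtain k \<sigma> :: int and t where a: "\<sigma> \<in> {1, - 1}" "0 \<le> t" "t \<le> 1/2" "a = of_int k + of_int \<sigma> * t"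
      by (rule nearest_integer_cases)
    have bij: "bij (\<lambda>i. k + \<sigma> * zigzag i)"
      by (rule bij_signed_zigzag[OF a(1)])
    obtain n0 where n0: "\<And>n g. n \<ge> n0 \<Longrightarrow>
        (\<Sum>x\<in>T. p x * g x) = (\<Sum>i<n. p (k + \<sigma> * zigzag i) * g (k + \<sigma> * zigzag i))"
      by (rule sum_eq_enumeration[OF bij T(1) pT]) auto
    \<comment> \<open>The isometry \<open>x \<mapsto> k + \<sigma> * x\<close> carries
      \<open>t\<close> to \<open>a\<close>.\<close>
    have dist: "\<bar>real_of_int (k + \<sigma> * zigzag i) - a\<bar> = \<bar>real_of_int (zigzag i) - t\<bar>" for i
      using a(1,4) by auto
    have "(\<Sum>i\<in>A. p (k + \<sigma> * zigzag i)) \<le> sum s {..<card A}" if "finite A" for A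
    proof -
      have inj: "inj_on (\<lambda>i. k + \<sigma> * zigzag i) A"
        using bij by (auto simp: bij_def intro: inj_on_subset)
      then show ?thesis
        using s(5)[of "(\<lambda>i. k + \<sigma> * zigzag i) ` A"] that by (simp add: sum.reindex card_image)
    qed
    moreover have "L a = (\<Sum>i<n. p (k + \<sigma> * zigzag i) * f \<bar>of_int (zigzag i) - t\<bar>)
        \<and> (\<Sum>i<n. p (k + \<sigma> * zigzag i)) = 1" if "n \<ge> max n0 K" for n
      using n0[of n "\<lambda>x. f \<bar>of_int x - a\<bar>"] n0[of n "\<lambda>_. 1"] that T(2)
      unfolding dist L_def by simp
    ultimately show ?thesis
      using a(1-3) by (intro exI[of _ k] exI[of _ \<sigma>] exI[of _ t] exI[of _ "max n0 K"]) auto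
  qed

  have F_le_L: "\<exists>t. F t \<le> L a" for a
  proof -
    from compare[of a] obtain k \<sigma> t n0 where c: "0 \<le> t" "t \<le> 1/2" "n0 \<ge> K"
      "L a = (\<Sum>i<n0. p (k + \<sigma> * zigzag i) * f \<bar>of_int (zigzag i) - t\<bar>)"
      "(\<Sum>i<n0. p (k + \<sigma> * zigzag i)) = 1"
      "\<And>A. finite A \<Longrightarrow> (\<Sum>i\<in>A. p (k + \<sigma> * zigzag i)) \<le> sum s {..<card A}"
      by blast
    have "F t \<le> L a"
      unfolding F_eq[OF c(3)] c(4)
      by (rule rearrangement_le[OF cmono[OF c(1,2)]])
        (use c(5) c(6)[of "{..<_}"] s_total[OF c(3)] in auto)
    then show ?thesis ..
  qed
  have DN: "D\<^sub>f f N Xplus \<le> ennreal (F t)" for t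
    unfolding D\<^sub>f_def ELY by (rule INF_lower) simp
  have le: "D\<^sub>f f N Xplus \<le> D\<^sub>f f M X"
    unfolding D\<^sub>f_def[of f M]
  proof (rule INF_greatest)
    fix a
    obtain t where "F t \<le> L a" using F_le_L by blast
    then show "D\<^sub>f f N Xplus \<le> expected_loss f M X a"
      using order_trans[OF DN ennreal_leI] by (simp add: ELX)
  qed

  \<comment> \<open>Strictness is proved by contraposition: equal infima force one of the two
    distributions.\<close>
  have "\<exists>k::int. same_distr M (\<lambda>\<omega>. X \<omega> - of_int k) N Xplus \<or>
      same_distr M (\<lambda>\<omega>. X \<omega> - of_int k) N (\<lambda>\<omega>. - Xplus \<omega>)"
    if f: "\<forall>x>0. f differentiable (at x) \<and> deriv f x > 0" "(f has_real_derivative 0) (at_right 0)"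
      and eq: "D\<^sub>f f M X \<le> D\<^sub>f f N Xplus"
  proof -
    have cont: "continuous_on UNIV (\<lambda>x. f \<bar>x\<bar>)"
      using DERIV_comp_abs[of f] f
      by (intro continuous_at_imp_continuous_on) (blast intro: DERIV_isCont)
    have "T \<noteq> {}" using T(2) by auto
    obtain a where a: "\<And>b. L a \<le> L b"
      unfolding L_def
      by (rule discrete_loss_attains_min[of T p f]) (use T(1) \<open>T \<noteq> {}\<close> p0 assms(6) cont in auto)
    have DM: "D\<^sub>f f M X = ennreal (L a)"
      using D\<^sub>f_eq_min[of f M X a] a by (simp add: ELX ennreal_leI)
    \<comment> \<open>The minimum \<open>L a\<close> of the loss of \<open>X\<close> is at most the
      infimum for \<open>Xplus\<close>, hence at most every value of \<open>F\<close>.\<close>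
    have LF: "L a \<le> F b" for b
      using order_trans[OF eq DN[of b]] F_nonneg[of b] by (simp add: DM ennreal_le_iff)
    from compare[of a] obtain k \<sigma> t n0 where c: "\<sigma> \<in> {1, - 1}" "0 \<le> t" "t \<le> 1/2" "n0 \<ge> K"
      and c': "\<And>n. n \<ge> n0 \<Longrightarrow>
        L a = (\<Sum>i<n. p (k + \<sigma> * zigzag i) * f \<bar>of_int (zigzag i) - t\<bar>)"
      "\<And>n. n \<ge> n0 \<Longrightarrow> (\<Sum>i<n. p (k + \<sigma> * zigzag i)) = 1"
      "\<And>A. finite A \<Longrightarrow> (\<Sum>i\<in>A. p (k + \<sigma> * zigzag i)) \<le> sum s {..<card A}"
      by blast
    have "F t \<le> L a"
      unfolding F_eq[OF c(4)] c'(1)[OF order_refl]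
      by (rule rearrangement_le[OF cmono[OF c(2,3)]])
        (use c'(2)[OF order_refl] c'(3)[of "{..<_}"] s_total[OF c(4)] in auto)
    \<comment> \<open>With \<open>LF\<close> this makes \<open>t\<close> a minimiser of
      \<open>F\<close>, as the treatment of ties requires.\<close>
    then have FL: "F t = L a" using LF[of t] by simp
    have smono: "f x < f y \<longleftrightarrow> x < y" "f x = f y \<longleftrightarrow> x = y" if "x \<ge> 0" "y \<ge> 0" for x y
      using strict_mono_on_of_deriv_pos[OF assms(6) f(1)] that
      by (auto simp: strict_mono_on_less strict_mono_on_eq)
    have q: "p (k + \<sigma> * zigzag i) = s i" for i
    proof (rule rearrangement_eqD[OF cmono[OF c(2,3)] c'(3), of n0])
      fix n assume n: "n \<ge> n0"
      then show "(\<Sum>i<n. p (k + \<sigma> * zigzag i)) = sum s {..<n}"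
        using c'(2) s_total c(4) by simp
      show "(\<Sum>i<n. s i * f \<bar>of_int (zigzag i) - t\<bar>)
          = (\<Sum>i<n. p (k + \<sigma> * zigzag i) * f \<bar>of_int (zigzag i) - t\<bar>)"
        using FL F_eq[of n t] c'(1)[OF n] n c(4) by simp
    next
      fix m
      show "f \<bar>of_int (zigzag m) - t\<bar> < f \<bar>of_int (zigzag (Suc m)) - t\<bar> \<or>
        f \<bar>of_int (zigzag (Suc m)) - t\<bar> < f \<bar>of_int (zigzag (Suc (Suc m))) - t\<bar>"
        using zigzag_dist_no_triple[OF c(2,3), of m] by (simp add: smono)
      assume "f \<bar>of_int (zigzag m) - t\<bar> = f \<bar>of_int (zigzag (Suc m)) - t\<bar>"
      then have tie: "\<bar>real_of_int (zigzag m) - t\<bar> = \<bar>real_of_int (zigzag (Suc m)) - t\<bar>"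
        by (simp add: smono)
      show "s m = s (Suc m)"
        by (rule zigzag_minimiser_tie[OF s(1,2) f c(2,3) _ tie])
          (use LF FL in \<open>auto simp: F_def\<close>)
    qed auto
    \<comment> \<open>These points carry the whole mass of \<open>\<sigma> * Xplus\<close>. Keeping
      the sign \<open>\<sigma>\<close> treats \<open>Xplus\<close> and \<open>- Xplus\<close>
      together.\<close>
    define T' where "T' = (\<lambda>i. \<sigma> * zigzag i) ` {..<K}"
    have inj': "inj_on (\<lambda>i. \<sigma> * zigzag i) {..<K}"
      using bij_signed_zigzag[OF c(1), of 0] by (auto simp: bij_def intro: inj_on_subset)
    have shift: "prob_at M (\<lambda>\<omega>. X \<omega> - of_int k) m = p (k + m)" for m
      by (auto simp: p_def prob_at_def algebra_simps intro!: arg_cong[where f = "measure M"])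
    have sum': "(\<Sum>m\<in>T'. prob_at M (\<lambda>\<omega>. X \<omega> - of_int k) m) = 1"
      unfolding T'_def by (subst sum.reindex[OF inj']) (simp add: shift q s(4))
    have "same_distr M (\<lambda>\<omega>. X \<omega> - of_int k) N (\<lambda>\<omega>. of_int \<sigma> * Xplus \<omega>)"
    proof (rule same_distr_int_valuedI[OF assms(1) _ N.prob_space_axioms _ _ sum'])
      fix m assume "m \<in> T'"
      then obtain i where i: "i < K" "m = \<sigma> * zigzag i" by (auto simp: T'_def)
      have "{\<omega> \<in> space N. of_int \<sigma> * Xplus \<omega> = of_int m} = {\<omega> \<in> space N. Xplus \<omega> = of_int (zigzag i)}"
        using c(1) i(2) by auto
      then have "prob_at N (\<lambda>\<omega>. of_int \<sigma> * Xplus \<omega>) m = prob_at N Xplus (zigzag i)"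
        by (simp add: prob_at_def)
      then show "prob_at M (\<lambda>\<omega>. X \<omega> - of_int k) m = prob_at N (\<lambda>\<omega>. of_int \<sigma> * Xplus \<omega>) m"
        using i by (simp add: shift q Ys)
    qed (auto simp: T'_def)
    then show ?thesis
      using c(1) by (intro exI[of _ k]) auto
  qed
  with le show ?thesis
    by (meson not_le)
qed

end
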